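(* Let $Y$ be a separable Banach space, let $(\zeta^{(k)})_{k\in\mathbb{N}}$ be a sequence of pairwise distinct elements whose set of members is a dense subset of the unit sphere of $Y$, and let $A_{\mathrm{Maz}}:\ell^1\to Y$ be the Mazur-type operator $A_{\mathrm{Maz}}\,x=\sum_{k=1}^\infty x_k\,\zeta^{(k)}$. Let $Z$ be a Banach space and let $C:Y\to Z$ be a bounded linear operator with $C\neq 0$. Then $A:=C\circ A_{\mathrm{Maz}}:\ell^1\to Z$ is not weak*-to-weak continuous.
   Context: $\ell^1$ is the space of absolutely summable sequences indexed by $\mathbb{N}=\{1,2,\ldots\}$ with its usual norm. Mazur-type operator: for a separable Banach space $Y$ and a sequence $(\zeta^{(k)})_{k\in\mathbb{N}}$ with $\zeta^{(k)}\neq\zeta^{(l)}$ for $k\neq l$ whose members form a countable dense subset of the unit sphere of $Y$, the associated Mazur-type operator is the bounded linear operator $\ell^1\to Y$, $x=(x_1,x_2,\ldots)\mapsto\sum_{k=1}^\infty x_k\,\zeta^{(k)}$; it maps $\ell^1$ onto $Y$. Weak*-to-weak continuity: a bounded linear operator $A:\ell^1\to Z$ is called weak*-to-weak continuous if it transforms weak*-convergent sequences in $\ell^1$ into weakly convergent sequences in $Z$ (with the image of the weak* limit as weak limit), where weak* convergence in $\ell^1$ is taken with respect to the predual space $c_0$ (the null sequences with the supremum norm) of $\ell^1$. *)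

theory Defs
  imports "HOL-Analysis.Analysis"
begin

text \<open>
  Scalars are real.  Sequences are indexed by \<^typ>\<open>nat\<close>, so the index \<open>k\<close> here is
  the index \<open>k + 1\<close> in the convention where sequences start at 1.  The spaces
  \<open>\<ell>\<^sup>1\<close> and \<open>c\<^sub>0\<close> are carrier sets of real sequences, and operators on \<open>\<ell>\<^sup>1\<close> are
  functions whose values matter on the carrier only.
\<close>

definition ell1 :: "(nat \<Rightarrow> real) set" where
  "ell1 = {x. summable (\<lambda>k. \<bar>x k\<bar>)}"

definition ell1_norm :: "(nat \<Rightarrow> real) \<Rightarrow> real" where
  "ell1_norm x = (\<Sum>k. \<bar>x k\<bar>)"

definition c0 :: "(nat \<Rightarrow> real) set" where
  "c0 = {c. c \<longlonglongrightarrow> 0}"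

text \<open>
  Weak* convergence in \<open>\<ell>\<^sup>1\<close> as the dual of \<open>c\<^sub>0\<close>: an element \<open>x\<close> acts on \<open>c\<close> by
  \<open>\<Sum>k. x k * c k\<close>.
\<close>

definition ell1_weak_star_tendsto :: "(nat \<Rightarrow> nat \<Rightarrow> real) \<Rightarrow> (nat \<Rightarrow> real) \<Rightarrow> bool" where
  "ell1_weak_star_tendsto X x \<longleftrightarrow>
     (\<forall>n. X n \<in> ell1) \<and> x \<in> ell1 \<and>
     (\<forall>c\<in>c0. (\<lambda>n. \<Sum>k. X n k * c k) \<longlonglongrightarrow> (\<Sum>k. x k * c k))"

definition weakly_tendsto :: "(nat \<Rightarrow> 'z::real_normed_vector) \<Rightarrow> 'z \<Rightarrow> bool" where
  "weakly_tendsto z l \<longleftrightarrow>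
     (\<forall>\<phi> :: 'z \<Rightarrow>\<^sub>L real. (\<lambda>n. blinfun_apply \<phi> (z n)) \<longlonglongrightarrow> blinfun_apply \<phi> l)"

definition weak_star_to_weak_continuous ::
    "((nat \<Rightarrow> real) \<Rightarrow> 'z::real_normed_vector) \<Rightarrow> bool" where
  "weak_star_to_weak_continuous A \<longleftrightarrow>
     (\<forall>X x. ell1_weak_star_tendsto X x \<longrightarrow> weakly_tendsto (\<lambda>n. A (X n)) (A x))"

definition dense_sequence_in_unit_sphere :: "(nat \<Rightarrow> 'y::real_normed_vector) \<Rightarrow> bool" where
  "dense_sequence_in_unit_sphere \<zeta> \<longleftrightarrow>
     inj \<zeta> \<and> range \<zeta> \<subseteq> sphere 0 1 \<and> sphere 0 1 \<subseteq> closure (range \<zeta>)"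

definition mazur :: "(nat \<Rightarrow> 'y::banach) \<Rightarrow> (nat \<Rightarrow> real) \<Rightarrow> 'y" where
  "mazur \<zeta> x = (\<Sum>k. x k *\<^sub>R \<zeta> k)"

text \<open>
  The defining series converges absolutely, and \<^const>\<open>mazur\<close> is linear and bounded
  on \<open>\<ell>\<^sup>1\<close>.
\<close>

lemma dense_sequence_norm:
  assumes "dense_sequence_in_unit_sphere \<zeta>"
  shows "norm (\<zeta> k) = 1"
proof -
  have "\<zeta> k \<in> sphere 0 1"
    using assms unfolding dense_sequence_in_unit_sphere_def by blast
  then show ?thesis
    by simp
qed

lemma mazur_abs_summable:
  assumes "dense_sequence_in_unit_sphere \<zeta>" "x \<in> ell1"
  shows "summable (\<lambda>k. norm (x k *\<^sub>R \<zeta> k))"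
proof -
  have "norm (\<zeta> k) = 1" for k
    using dense_sequence_norm[OF assms(1)] .
  then show ?thesis
    using assms(2) by (simp add: ell1_def)
qed

lemma mazur_sums:
  assumes "dense_sequence_in_unit_sphere \<zeta>" "x \<in> ell1"
  shows "(\<lambda>k. x k *\<^sub>R \<zeta> k) sums mazur \<zeta> x"
  unfolding mazur_def
  by (rule summable_sums[OF summable_norm_cancel[OF mazur_abs_summable[OF assms]]])

lemma mazur_add:
  assumes "dense_sequence_in_unit_sphere \<zeta>" "x \<in> ell1" "y \<in> ell1"
  shows "mazur \<zeta> (\<lambda>k. x k + y k) = mazur \<zeta> x + mazur \<zeta> y"
proof -
  have "(\<lambda>k. (x k + y k) *\<^sub>R \<zeta> k) sums (mazur \<zeta> x + mazur \<zeta> y)"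
    using sums_add[OF mazur_sums[OF assms(1,2)] mazur_sums[OF assms(1,3)]]
    by (simp add: scaleR_add_left)
  then show ?thesis
    by (simp add: mazur_def sums_iff)
qed

lemma mazur_scale:
  assumes "dense_sequence_in_unit_sphere \<zeta>" "x \<in> ell1"
  shows "mazur \<zeta> (\<lambda>k. a * x k) = a *\<^sub>R mazur \<zeta> x"
proof -
  have "(\<lambda>k. (a * x k) *\<^sub>R \<zeta> k) sums (a *\<^sub>R mazur \<zeta> x)"
    using bounded_linear.sums[OF bounded_linear_scaleR_right mazur_sums[OF assms], of a]
    by simp
  then show ?thesis
    by (simp add: mazur_def sums_iff)
qed

lemma norm_mazur_le:
  assumes "dense_sequence_in_unit_sphere \<zeta>" "x \<in> ell1"
  shows "norm (mazur \<zeta> x) \<le> ell1_norm x"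
proof -
  have "norm (\<zeta> k) = 1" for k
    using dense_sequence_norm[OF assms(1)] .
  then show ?thesis
    using summable_norm[OF mazur_abs_summable[OF assms]]
    by (simp add: mazur_def ell1_norm_def)
qed

end

theory Submission
  imports Defs
begin

text \<open>
  The unit vectors \<open>e\<^sub>n\<close> of \<open>\<ell>\<^sup>1\<close> converge weak* to \<open>0\<close>, because pairing \<open>e\<^sub>n\<close> with
  \<open>c \<in> c\<^sub>0\<close> gives \<open>c n\<close>.  The Mazur operator sends \<open>e\<^sub>n\<close> to \<open>\<zeta> n\<close>, so weak*-to-weak
  continuity of \<open>C \<circ> mazur \<zeta>\<close> would force \<open>\<phi> (C (\<zeta> n)) \<longlonglongrightarrow> 0\<close> for every bounded
  functional \<open>\<phi>\<close>.

  This fails.  Choose a unit vector \<open>y\<close> with \<open>C y \<noteq> 0\<close> and, by the Hahn-Banach theorem,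
  a bounded functional \<open>\<phi>\<close> with \<open>\<phi> (C y) = \<parallel>C y\<parallel> > 0\<close>.  The sphere contains the infinitely
  many points \<open>\<zeta> k\<close>, so the space is at least two-dimensional and the sphere has no
  isolated points.  By density, every neighbourhood of \<open>y\<close> then contains \<open>\<zeta> k\<close> for
  infinitely many \<open>k\<close>, and on a suitable neighbourhood \<open>\<phi> \<circ> C\<close> stays above
  \<open>\<parallel>C y\<parallel> / 2\<close>.

  The Hahn-Banach theorem is obtained here in the form that every vector is normed by a
  functional (\<open>norming_functional_exists\<close>).  Extension of functionals from subspaces is
  avoided: linear functionals are exactly the minimal sublinear ones, and Zorn's lemma
  provides a minimal sublinear functional below a given one.
\<close>

section \<open>Minimal sublinear functionals\<close>

text \<open>
  Inequality suffices for homogeneity: applied to \<open>t\<close> and \<open>1 / t\<close> it gives equality.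
\<close>

definition sublinear :: "('a::real_vector \<Rightarrow> real) \<Rightarrow> bool" where
  "sublinear p \<longleftrightarrow>
     (\<forall>x y. p (x + y) \<le> p x + p y) \<and> (\<forall>t>0. \<forall>x. p (t *\<^sub>R x) \<le> t * p x)"

lemma sublinear_add: "sublinear p \<Longrightarrow> p (x + y) \<le> p x + p y"
  by (simp add: sublinear_def)

lemma sublinear_scale_le: "sublinear p \<Longrightarrow> 0 < t \<Longrightarrow> p (t *\<^sub>R x) \<le> t * p x"
  by (simp add: sublinear_def)

lemma sublinear_zero:
  assumes "sublinear p"
  shows "p 0 = 0"
  using sublinear_scale_le[OF assms, of 2 0] sublinear_scale_le[OF assms, of "1/2" 0]
  by simp

lemma sublinear_scale:
  assumes "sublinear p" "0 \<le> t"
  shows "p (t *\<^sub>R x) = t * p x"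
proof (cases "t = 0")
  case True
  then show ?thesis by (simp add: sublinear_zero[OF assms(1)])
next
  case False
  with assms(2) have t: "0 < t" by simp
  have "p x \<le> (1 / t) * p (t *\<^sub>R x)"
    using sublinear_scale_le[OF assms(1), of "1 / t" "t *\<^sub>R x"] t by simp
  then have "t * p x \<le> p (t *\<^sub>R x)"
    using t by (simp add: field_simps)
  with sublinear_scale_le[OF assms(1) t, of x] show ?thesis by simp
qed

lemma sublinear_lower_bound:
  assumes "sublinear p"
  shows "- p (- x) \<le> p x"
  using sublinear_add[OF assms, of x "- x"] sublinear_zero[OF assms] by simp

lemma sublinear_norm: "sublinear (norm :: 'a::real_normed_vector \<Rightarrow> real)"
  by (simp add: sublinear_def norm_triangle_ineq)

text \<open>
  The members of the family need not be sublinear themselves; it is enough that the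
  defining inequalities hold across the family.  This covers both uses below: a chain of
  sublinear functionals, and the shifts of one functional along a ray.
\<close>

lemma sublinear_INF:
  fixes f :: "'i \<Rightarrow> 'a::real_vector \<Rightarrow> real"
  assumes nonempty: "I \<noteq> {}"
    and bdd: "\<And>x. bdd_below ((\<lambda>i. f i x) ` I)"
    and add: "\<And>i j x y. i \<in> I \<Longrightarrow> j \<in> I \<Longrightarrow> \<exists>k\<in>I. f k (x + y) \<le> f i x + f j y"
    and scale: "\<And>i t x. i \<in> I \<Longrightarrow> 0 < t \<Longrightarrow> \<exists>k\<in>I. f k (t *\<^sub>R x) \<le> t * f i x"
  shows "sublinear (\<lambda>x. INF i\<in>I. f i x)"
proof -
  let ?q = "\<lambda>x. INF i\<in>I. f i x"
  have lower: "?q x \<le> f i x" if "i \<in> I" for i x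
    using cINF_lower[OF bdd that] .
  have "?q (x + y) \<le> ?q x + ?q y" for x y
  proof -
    have "?q (x + y) - f j y \<le> ?q x" if j: "j \<in> I" for j
    proof (rule cINF_greatest[OF nonempty])
      fix i assume "i \<in> I"
      then obtain k where "k \<in> I" "f k (x + y) \<le> f i x + f j y"
        using add j by blast
      then show "?q (x + y) - f j y \<le> f i x"
        using lower[of k "x + y"] by simp
    qed
    then have "?q (x + y) - ?q x \<le> ?q y"
      by (intro cINF_greatest[OF nonempty]) (simp add: algebra_simps)
    then show ?thesis by simp
  qed
  moreover have "?q (t *\<^sub>R x) \<le> t * ?q x" if t: "0 < t" for t x
  proof -
    have "?q (t *\<^sub>R x) / t \<le> ?q x"
    proof (rule cINF_greatest[OF nonempty])
      fix i assume "i \<in> I"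
      then obtain k where "k \<in> I" "f k (t *\<^sub>R x) \<le> t * f i x"
        using scale t by blast
      then have "?q (t *\<^sub>R x) \<le> t * f i x"
        using lower[of k "t *\<^sub>R x"] by simp
      then show "?q (t *\<^sub>R x) / t \<le> f i x"
        using t by (simp add: field_simps)
    qed
    then show ?thesis using t by (simp add: field_simps)
  qed
  ultimately show ?thesis by (simp add: sublinear_def)
qed

text \<open>
  For sublinear \<open>p\<close> this is the largest sublinear functional below \<open>p\<close> that takes the
  value \<open>- p a\<close> at \<open>- a\<close>: any such \<open>r\<close> satisfies
  \<open>r x \<le> r (x + t *\<^sub>R a) + t * r (- a) \<le> p (x + t *\<^sub>R a) - t * p a\<close>.
\<close>

definition ray_lowering :: "('a::real_vector \<Rightarrow> real) \<Rightarrow> 'a \<Rightarrow> 'a \<Rightarrow> real" where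
  "ray_lowering p a x = (INF t\<in>{0..}. p (x + t *\<^sub>R a) - t * p a)"

lemma bdd_below_ray_lowering:
  assumes "sublinear p"
  shows "bdd_below ((\<lambda>t. p (x + t *\<^sub>R a) - t * p a) ` {0..})"
proof (rule bdd_belowI2)
  fix t :: real assume t: "t \<in> {0..}"
  have "t * p a = p ((x + t *\<^sub>R a) + (- x))"
    using sublinear_scale[OF assms, of t a] t by simp
  also have "\<dots> \<le> p (x + t *\<^sub>R a) + p (- x)"
    by (rule sublinear_add[OF assms])
  finally show "- p (- x) \<le> p (x + t *\<^sub>R a) - t * p a" by simp
qed

lemma ray_lowering_le:
  assumes "sublinear p" "0 \<le> t"
  shows "ray_lowering p a x \<le> p (x + t *\<^sub>R a) - t * p a"
  unfolding ray_lowering_def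
  by (rule cINF_lower[OF bdd_below_ray_lowering[OF assms(1)]]) (use assms(2) in simp)

lemma ray_lowering_le_self: "sublinear p \<Longrightarrow> ray_lowering p a \<le> p"
  using ray_lowering_le[of p 0 a] by (simp add: le_fun_def)

lemma sublinear_ray_lowering:
  assumes p: "sublinear p"
  shows "sublinear (ray_lowering p a)"
  unfolding ray_lowering_def
proof (rule sublinear_INF)
  fix s t :: real and x y
  assume st: "s \<in> {0..}" "t \<in> {0..}"
  have "p ((x + y) + (s + t) *\<^sub>R a) \<le> p (x + s *\<^sub>R a) + p (y + t *\<^sub>R a)"
    using sublinear_add[OF p, of "x + s *\<^sub>R a" "y + t *\<^sub>R a"] by (simp add: algebra_simps)
  then show "\<exists>k\<in>{0..}. p ((x + y) + k *\<^sub>R a) - k * p a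
      \<le> (p (x + s *\<^sub>R a) - s * p a) + (p (y + t *\<^sub>R a) - t * p a)"
    using st by (intro bexI[of _ "s + t"]) (simp_all add: algebra_simps)
next
  fix s t :: real and x
  assume st: "s \<in> {0..}" "0 < t"
  have "p (t *\<^sub>R x + (t * s) *\<^sub>R a) \<le> t * p (x + s *\<^sub>R a)"
    using sublinear_scale_le[OF p st(2), of "x + s *\<^sub>R a"] by (simp add: scaleR_add_right)
  then show "\<exists>k\<in>{0..}. p (t *\<^sub>R x + k *\<^sub>R a) - k * p a \<le> t * (p (x + s *\<^sub>R a) - s * p a)"
    using st by (intro bexI[of _ "t * s"]) (simp_all add: algebra_simps)
qed (use bdd_below_ray_lowering[OF p] in auto)

text \<open>
  By minimality \<open>q\<close> agrees with its own lowering along the ray through \<open>a\<close>; the term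
  \<open>t = 1\<close> of that infimum is the reverse of subadditivity at \<open>(x, a)\<close>.
\<close>

lemma minimal_sublinear_imp_linear:
  assumes q: "sublinear q"
    and minimal: "\<And>r. sublinear r \<Longrightarrow> r \<le> q \<Longrightarrow> r = q"
  shows "linear q"
proof -
  have add: "q (x + a) = q x + q a" for x a
  proof (rule antisym)
    have "ray_lowering q a = q"
      by (rule minimal[OF sublinear_ray_lowering[OF q] ray_lowering_le_self[OF q]])
    then show "q x + q a \<le> q (x + a)"
      using ray_lowering_le[OF q, of 1 a x] by simp
  qed (rule sublinear_add[OF q])
  have minus: "q (- x) = - q x" for x
    using add[of x "- x"] sublinear_zero[OF q] by simp
  have "q (t *\<^sub>R x) = t * q x" for t x
  proof (cases "0 \<le> t")
    case True
    then show ?thesis by (rule sublinear_scale[OF q])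
  next
    case False
    then have "q ((- t) *\<^sub>R x) = (- t) * q x"
      by (intro sublinear_scale[OF q]) simp
    then show ?thesis using minus[of "t *\<^sub>R x"] by simp
  qed
  with add show ?thesis by (intro linearI) simp_all
qed

text \<open>
  A chain of sublinear functionals below \<open>p\<close> is bounded below pointwise, since
  \<open>r x \<ge> - r (- x) \<ge> - p (- x)\<close>, so its pointwise infimum is again sublinear and
  Zorn's lemma applies.
\<close>

lemma linear_below_sublinear_exists:
  assumes p: "sublinear p"
  obtains q where "linear q" "q \<le> p"
proof -
  define S where "S = {r. sublinear r \<and> r \<le> p}"
  have "\<exists>m\<in>S. \<forall>r\<in>S. r \<le> m \<longrightarrow> r = m"
  proof (rule predicate_Zorn)
    show "partial_order_on S (relation_of (\<lambda>r s. s \<le> r) S)"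
      by (rule partial_order_on_relation_ofI) auto
  next
    fix K assume K: "K \<in> Chains (relation_of (\<lambda>r s. s \<le> r) S)"
    then have KS: "K \<subseteq> S"
      by (auto simp: Chains_def relation_of_def)
    have total: "r \<le> s \<or> s \<le> r" if "r \<in> K" "s \<in> K" for r s
      using K that by (auto simp: Chains_def relation_of_def)
    show "\<exists>u\<in>S. \<forall>r\<in>K. u \<le> r"
    proof (cases "K = {}")
      case True
      then show ?thesis using p by (auto simp: S_def)
    next
      case False
      have bdd: "bdd_below ((\<lambda>r. r x) ` K)" for x
      proof (rule bdd_belowI2)
        fix r assume "r \<in> K"
        then have r: "sublinear r" "r \<le> p" using KS by (auto simp: S_def)
        have "- p (- x) \<le> - r (- x)" using r(2) by (simp add: le_fun_def)
        also have "\<dots> \<le> r x" by (rule sublinear_lower_bound[OF r(1)])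
        finally show "- p (- x) \<le> r x" .
      qed
      let ?u = "\<lambda>x. INF r\<in>K. r x"
      have u_le: "?u \<le> r" if "r \<in> K" for r
        using cINF_lower[OF bdd that] by (simp add: le_fun_def)
      have "sublinear ?u"
      proof (rule sublinear_INF[OF False bdd])
        fix r s x y assume rs: "r \<in> K" "s \<in> K"
        \<comment> \<open>The smaller of two comparable functionals serves for the sum.\<close>
        have "\<exists>k\<in>K. k \<le> r \<and> k \<le> s" using total[OF rs] rs by blast
        then obtain k where k: "k \<in> K" "k \<le> r" "k \<le> s" by blast
        then have "k (x + y) \<le> k x + k y" using KS sublinear_add by (auto simp: S_def)
        also have "\<dots> \<le> r x + s y" using k by (intro add_mono) (auto simp: le_fun_def)
        finally show "\<exists>k\<in>K. k (x + y) \<le> r x + s y" using k(1) by blast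
      next
        fix r :: "'a \<Rightarrow> real" and t :: real and x assume "r \<in> K" "0 < t"
        then show "\<exists>k\<in>K. k (t *\<^sub>R x) \<le> t * r x"
          using KS sublinear_scale_le by (intro bexI[of _ r]) (auto simp: S_def)
      qed
      moreover have "?u \<le> p"
      proof -
        obtain r where "r \<in> K" using False by blast
        then show ?thesis using order_trans[OF u_le] KS by (auto simp: S_def)
      qed
      ultimately show ?thesis using u_le by (intro bexI[of _ ?u]) (auto simp: S_def)
    qed
  qed
  then obtain q where q: "sublinear q" "q \<le> p"
    and "\<And>r. r \<in> S \<Longrightarrow> r \<le> q \<Longrightarrow> r = q"
    by (auto simp: S_def)
  then have "linear q"
    by (intro minimal_sublinear_imp_linear) (simp_all add: S_def order_trans[OF _ q(2)])
  with q(2) show thesis by (rule that[rotated])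
qed

section \<open>Norming functionals\<close>

text \<open>
  The norm is lowered along the ray through \<open>z\<close> first.  Every linear \<open>q\<close> below the result
  satisfies \<open>q (- z) \<le> - \<parallel>z\<parallel>\<close>, and it is still dominated by the norm, hence bounded.
\<close>

theorem norming_functional_exists:
  fixes z :: "'a::real_normed_vector"
  obtains \<phi> :: "'a \<Rightarrow>\<^sub>L real" where "blinfun_apply \<phi> z = norm z"
proof -
  obtain q where q: "linear q" "q \<le> ray_lowering norm z"
    by (rule linear_below_sublinear_exists[OF sublinear_ray_lowering[OF sublinear_norm]])
  have le_norm: "q x \<le> norm x" for x
    using q(2) ray_lowering_le_self[OF sublinear_norm, of z]
    by (meson le_funD order_trans)
  have abs_le: "\<bar>q x\<bar> \<le> norm x" for x
    using le_norm[of x] le_norm[of "- x"] linear_neg[OF q(1), of x] by simp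
  have bounded: "bounded_linear q"
    using q(1) abs_le
    by (intro bounded_linear_intro[where K = 1]) (simp_all add: linear_add linear_scale)
  have "q (- z) \<le> - norm z"
    using le_funD[OF q(2), of "- z"] ray_lowering_le[OF sublinear_norm, of 1 z "- z"] by simp
  with le_norm[of z] linear_neg[OF q(1), of z] have "q z = norm z" by simp
  with bounded show thesis
    by (intro that[of "Blinfun q"]) (simp add: bounded_linear_Blinfun_apply)
qed

section \<open>Accumulation on the unit sphere\<close>

text \<open>
  The segment from \<open>y\<close> to \<open>w\<close> misses the origin, and its radial projection is a connected
  subset of the sphere that contains \<open>y\<close> and the different point \<open>w\<close>.
\<close>

lemma islimpt_unit_sphere:
  fixes y w :: "'a::real_normed_vector"
  assumes y: "norm y = 1" and w: "norm w = 1" and ne: "w \<noteq> y" "w \<noteq> - y"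
  shows "y islimpt sphere 0 1"
proof -
  let ?S = "(\<lambda>x. x /\<^sub>R norm x) ` closed_segment y w"
  have nz: "0 \<notin> closed_segment y w"
  proof
    assume "0 \<in> closed_segment y w"
    then obtain u where u: "0 \<le> u" "u \<le> 1" and eq: "(1 - u) *\<^sub>R y + u *\<^sub>R w = 0"
      by (auto simp: in_segment)
    from eq have eq': "(1 - u) *\<^sub>R y = - (u *\<^sub>R w)"
      by (simp add: eq_neg_iff_add_eq_0)
    then have "norm ((1 - u) *\<^sub>R y) = norm (u *\<^sub>R w)" by simp
    then have "u = 1 / 2" using u y w by simp
    with eq' have "(1 / 2) *\<^sub>R y = (1 / 2) *\<^sub>R (- w)" by simp
    then have "y = - w" by (subst (asm) scaleR_cancel_left) simp
    with ne(2) show False by simp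
  qed
  have conn: "connected ?S"
    using nz by (intro connected_continuous_image continuous_intros connected_segment) auto
  have yS: "y \<in> ?S"
    using y by (intro image_eqI[of _ _ y]) auto
  have wS: "w \<in> ?S"
    using w by (intro image_eqI[of _ _ w]) auto
  have "?S \<noteq> {x}" for x
  proof
    assume "?S = {x}"
    with yS wS have "y = x" "w = x" by (simp_all only: singleton_iff)
    with ne(1) show False by simp
  qed
  with conn yS have "y islimpt ?S" by (rule connected_imp_perfect)
  moreover have "?S \<subseteq> sphere 0 1"
  proof
    fix v assume "v \<in> ?S"
    then obtain x where "x \<in> closed_segment y w" "v = x /\<^sub>R norm x" by blast
    then show "v \<in> sphere 0 1" using nz by (cases "x = 0") auto
  qed
  ultimately show ?thesis by (rule islimpt_subset)
qed

text \<open>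
  Injectivity provides a member of the sequence other than \<open>\<plusminus>y\<close>; on the two-point sphere of
  a line there would be none.
\<close>

lemma islimpt_dense_sequence:
  assumes dense: "dense_sequence_in_unit_sphere \<zeta>" and y: "norm y = 1"
  shows "y islimpt range \<zeta>"
proof -
  have "infinite (range \<zeta>)"
    using dense by (simp add: dense_sequence_in_unit_sphere_def range_inj_infinite)
  then have "\<not> range \<zeta> \<subseteq> {y, - y}"
    by (rule contrapos_nn) (erule finite_subset, simp)
  then obtain k where "\<zeta> k \<noteq> y" "\<zeta> k \<noteq> - y" by blast
  then have "y islimpt sphere 0 1"
    using islimpt_unit_sphere[OF y dense_sequence_norm[OF dense]] by blast
  then have "y islimpt closure (range \<zeta>)"
    by (rule islimpt_subset) (use dense in \<open>simp add: dense_sequence_in_unit_sphere_def\<close>)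
  then show ?thesis by (simp only: limpt_of_closure)
qed

text \<open>
  A functional tending to \<open>0\<close> along the sequence exceeds half of its value at \<open>y\<close> only
  finitely often, while every neighbourhood of \<open>y\<close> is visited infinitely often.
\<close>

lemma functional_not_null_on_dense_sequence:
  fixes \<psi> :: "'a::real_normed_vector \<Rightarrow>\<^sub>L real"
  assumes dense: "dense_sequence_in_unit_sphere \<zeta>"
    and y: "norm y = 1" "0 < blinfun_apply \<psi> y"
  shows "\<not> (\<lambda>k. blinfun_apply \<psi> (\<zeta> k)) \<longlonglongrightarrow> 0"
proof
  assume lim: "(\<lambda>k. blinfun_apply \<psi> (\<zeta> k)) \<longlonglongrightarrow> 0"
  let ?U = "{x. blinfun_apply \<psi> y / 2 < blinfun_apply \<psi> x}"
  have "open ?U"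
    by (intro open_Collect_less continuous_intros)
  moreover have "y \<in> ?U" using y(2) by simp
  moreover have "\<forall>U. y \<in> U \<longrightarrow> open U \<longrightarrow> infinite (U \<inter> range \<zeta>)"
    using islimpt_dense_sequence[OF dense y(1)] by (simp only: islimpt_eq_acc_point)
  ultimately have inf: "infinite (?U \<inter> range \<zeta>)" by (elim allE impE)
  have "eventually (\<lambda>k. blinfun_apply \<psi> (\<zeta> k) < blinfun_apply \<psi> y / 2) sequentially"
    by (rule order_tendstoD(2)[OF lim]) (use y(2) in simp)
  then obtain N where N: "\<And>k. N \<le> k \<Longrightarrow> blinfun_apply \<psi> (\<zeta> k) < blinfun_apply \<psi> y / 2"
    by (auto simp: eventually_sequentially)
  have "?U \<inter> range \<zeta> \<subseteq> \<zeta> ` {..<N}"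
  proof clarify
    fix k assume "blinfun_apply \<psi> y / 2 < blinfun_apply \<psi> (\<zeta> k)"
    then have "k < N" using N[of k] by (cases "N \<le> k") auto
    then show "\<zeta> k \<in> \<zeta> ` {..<N}" by simp
  qed
  then have "finite (?U \<inter> range \<zeta>)" by (rule finite_subset) simp
  with inf show False by contradiction
qed

section \<open>Unit vectors and the Mazur operator\<close>

definition unit_seq :: "nat \<Rightarrow> nat \<Rightarrow> real" where
  "unit_seq n k = (if k = n then 1 else 0)"

lemma unit_seq_weak_star_null: "ell1_weak_star_tendsto unit_seq (\<lambda>_. 0)"
proof -
  have "(\<Sum>k. unit_seq n k * c k) = c n" for n and c :: "nat \<Rightarrow> real"
  proof -
    have "(\<Sum>k. unit_seq n k * c k) = (\<Sum>k\<in>{n}. unit_seq n k * c k)"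
      by (rule suminf_finite) (auto simp: unit_seq_def)
    then show ?thesis by (simp add: unit_seq_def)
  qed
  moreover have "unit_seq n \<in> ell1" for n
    unfolding ell1_def mem_Collect_eq
    by (rule summable_finite[of "{n}"]) (auto simp: unit_seq_def)
  ultimately show ?thesis
    by (simp add: ell1_weak_star_tendsto_def c0_def ell1_def)
qed

lemma mazur_unit_seq: "mazur \<zeta> (unit_seq n) = \<zeta> n"
proof -
  have "mazur \<zeta> (unit_seq n) = (\<Sum>k\<in>{n}. unit_seq n k *\<^sub>R \<zeta> k)"
    unfolding mazur_def by (rule suminf_finite) (auto simp: unit_seq_def)
  then show ?thesis by (simp add: unit_seq_def)
qed

theorem theorem3p4:
  fixes \<zeta> :: "nat \<Rightarrow> 'y::banach"
    and C :: "'y \<Rightarrow>\<^sub>L 'z::banach"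
  assumes "separable_space (euclidean :: 'y topology)"
    and "dense_sequence_in_unit_sphere \<zeta>"
    and "C \<noteq> 0"
  shows "\<not> weak_star_to_weak_continuous (blinfun_apply C \<circ> mazur \<zeta>)"
proof
  assume "weak_star_to_weak_continuous (blinfun_apply C \<circ> mazur \<zeta>)"
  then have "weakly_tendsto (\<lambda>n. (blinfun_apply C \<circ> mazur \<zeta>) (unit_seq n))
      ((blinfun_apply C \<circ> mazur \<zeta>) (\<lambda>_. 0))"
    using unit_seq_weak_star_null unfolding weak_star_to_weak_continuous_def by blast
  then have "weakly_tendsto (\<lambda>n. blinfun_apply C (\<zeta> n)) 0"
    by (simp add: mazur_unit_seq) (simp add: mazur_def blinfun.zero_right)
  then have null: "(\<lambda>n. blinfun_apply \<phi> (blinfun_apply C (\<zeta> n))) \<longlonglongrightarrow> 0" for \<phi> :: "'z \<Rightarrow>\<^sub>L real"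
    by (simp add: weakly_tendsto_def blinfun.zero_right)
  obtain v where v: "blinfun_apply C v \<noteq> 0"
    using assms(3) by (metis blinfun_eqI zero_blinfun.rep_eq)
  then have "v \<noteq> 0" by (auto simp: blinfun.zero_right)
  define y where "y = v /\<^sub>R norm v"
  have y: "norm y = 1" "blinfun_apply C y \<noteq> 0"
    using v \<open>v \<noteq> 0\<close> by (simp_all add: y_def blinfun.scaleR_right)
  obtain \<phi> :: "'z \<Rightarrow>\<^sub>L real" where "blinfun_apply \<phi> (blinfun_apply C y) = norm (blinfun_apply C y)"
    by (rule norming_functional_exists)
  then have "0 < blinfun_apply (\<phi> o\<^sub>L C) y" using y(2) by simp
  from functional_not_null_on_dense_sequence[OF assms(2) y(1) this] null[of \<phi>]
  show False by simp
qed

end
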